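(* Let $V$ be a real vector space of finite dimension $m\ge 3$ and let $\mathcal{A}\in\mathfrak{F}(V)$ be an equiaffine algebraic curvature operator which is projectively flat. Then there exists an equiaffine projectively flat (torsion free) connection $\nabla$ on the tangent bundle $T(V)$ of the smooth manifold $V$ such that its curvature operator at the origin satisfies $\mathcal{R}_0^\nabla=\mathcal{A}$.
   Context: Let $V$ be a real vector space of finite dimension $m$. An algebraic curvature operator on $V$ is an element $\mathcal{A}\in\otimes^2V^*\otimes\operatorname{End}(V)$ such that for all $x,y,z\in V$: $\mathcal{A}(x,y)z=-\mathcal{A}(y,x)z$ and $\mathcal{A}(x,y)z+\mathcal{A}(y,z)x+\mathcal{A}(z,x)y=0$. The space of these is denoted $\mathfrak{A}(V)$. The Ricci tensor of $\mathcal{A}$ is $\rho(x,y):=\operatorname{Tr}\{z\mapsto\mathcal{A}(z,x)y\}$. $\mathcal{A}$ is called an equiaffine (or Ricci symmetric) curvature operator if $\rho(x,y)=\rho(y,x)$ for all $x,y\in V$; $\mathfrak{F}(V)\subset\mathfrak{A}(V)$ denotes the set of all such operators. For $\mathcal{A}\in\mathfrak{F}(V)$ the Weyl projective curvature operator is $$\mathcal{P}_{\mathcal{A}}(x,y)z:=\mathcal{A}(x,y)z-\tfrac1{m-1}\{\rho(y,z)x-\rho(x,z)y\},$$ and $\mathcal{A}$ is called projectively flat if $\mathcal{P}_{\mathcal{A}}=0$. All connections are smooth torsion free connections on the tangent bundle $TM$ of a smooth manifold $M$. The curvature operator of $\nabla$ is $\mathcal{R}^\nabla(X,Y)Z=\nabla_X\nabla_YZ-\nabla_Y\nabla_XZ-\nabla_{[X,Y]}Z$,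 and $\mathcal{R}^\nabla_P\in\mathfrak{A}(T_PM)$ denotes its value at $P\in M$. A connection is equiaffine if it locally admits a parallel volume form, i.e. every point has a neighborhood on which there is a nowhere vanishing top-degree form $\Omega$ with $\nabla\Omega=0$; equivalently, its Ricci tensor (defined from $\mathcal{R}^\nabla_P$ by the same trace formula at each point $P$) is symmetric. Two connections $\nabla$ and $\bar\nabla$ on $TM$ are projectively equivalent if there is a smooth $1$-form $\theta$ on $M$ with $\nabla_XY-\bar\nabla_XY=\theta(X)Y+\theta(Y)X$ for all vector fields $X,Y$. A connection is projectively flat if it is projectively equivalent to a flat connection (one with vanishing curvature operator). When $M=V$, the tangent space $T_0V$ is canonically identified with $V$. *)

theory Defs
  imports "HOL-Analysis.Analysis"
begin

text \<open>The vector space \<open>V\<close> of dimension \<open>m\<close> is an arbitrary type \<open>'a :: euclidean_space\<close> with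
  \<open>m = DIM('a)\<close>.  The inner product of this type class plays no role beyond providing the standard
  topology and smooth structure and a basis in which to compute traces.\<close>

section \<open>Algebraic curvature operators\<close>

text \<open>In \<open>A x y z\<close> the arguments are those of \<open>\<A>(x,y)z\<close>.\<close>

type_synonym 'a curvop = "'a \<Rightarrow> 'a \<Rightarrow> 'a \<Rightarrow> 'a"

definition lin_trace :: "('a::euclidean_space \<Rightarrow> 'a) \<Rightarrow> real" where
  "lin_trace f = (\<Sum>b\<in>Basis. f b \<bullet> b)"

definition algebraic_curvature_operator :: "'a::euclidean_space curvop \<Rightarrow> bool" where
  "algebraic_curvature_operator A \<longleftrightarrow>
     (\<forall>y z. linear (\<lambda>x. A x y z)) \<and>
     (\<forall>x z. linear (\<lambda>y. A x y z)) \<and>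
     (\<forall>x y. linear (\<lambda>z. A x y z)) \<and>
     (\<forall>x y z. A x y z = - A y x z) \<and>
     (\<forall>x y z. A x y z + A y z x + A z x y = 0)"

definition ricci :: "'a::euclidean_space curvop \<Rightarrow> 'a \<Rightarrow> 'a \<Rightarrow> real" where
  "ricci A x y = lin_trace (\<lambda>z. A z x y)"

definition equiaffine_curvature_operator :: "'a::euclidean_space curvop \<Rightarrow> bool" where
  "equiaffine_curvature_operator A \<longleftrightarrow>
     algebraic_curvature_operator A \<and> (\<forall>x y. ricci A x y = ricci A y x)"

definition weyl_projective :: "'a::euclidean_space curvop \<Rightarrow> 'a curvop" where
  "weyl_projective A x y z =
     A x y z - (1 / (real DIM('a) - 1)) *\<^sub>R (ricci A y z *\<^sub>R x - ricci A x z *\<^sub>R y)"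

definition projectively_flat_operator :: "'a::euclidean_space curvop \<Rightarrow> bool" where
  "projectively_flat_operator A \<longleftrightarrow> (\<forall>x y z. weyl_projective A x y z = 0)"

section \<open>Smooth functions and vector fields on \<open>V\<close>\<close>

text \<open>\<open>Ck_on n f S\<close> is meant for open \<open>S\<close>, where it says that \<open>f\<close> is of class \<open>C\<^sup>n\<close> on \<open>S\<close> (in finite
  dimension it suffices to consider the directional derivatives of \<open>f\<close>).\<close>

primrec Ck_on :: "nat \<Rightarrow> ('a::euclidean_space \<Rightarrow> 'b::real_normed_vector) \<Rightarrow> 'a set \<Rightarrow> bool" where
  "Ck_on 0 f S = continuous_on S f"
| "Ck_on (Suc n) f S =
     ((\<forall>p\<in>S. f differentiable (at p)) \<and>
      (\<forall>v. Ck_on n (\<lambda>p. frechet_derivative f (at p) v) S))"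

definition smooth_on :: "('a::euclidean_space \<Rightarrow> 'b::real_normed_vector) \<Rightarrow> 'a set \<Rightarrow> bool" where
  "smooth_on f S \<longleftrightarrow> (\<forall>n. Ck_on n f S)"

text \<open>Since \<open>TV = V \<times> V\<close> canonically, a smooth vector field on \<open>V\<close> is a smooth map \<open>V \<rightarrow> V\<close>, and
  tangent vectors at any point, in particular at the origin, are elements of \<open>V\<close>.\<close>

abbreviation smooth :: "('a::euclidean_space \<Rightarrow> 'b::real_normed_vector) \<Rightarrow> bool" where
  "smooth f \<equiv> smooth_on f UNIV"

definition lie_bracket ::
    "('a::euclidean_space \<Rightarrow> 'a) \<Rightarrow> ('a \<Rightarrow> 'a) \<Rightarrow> ('a \<Rightarrow> 'a)" where
  "lie_bracket X Y p =
     frechet_derivative Y (at p) (X p) - frechet_derivative X (at p) (Y p)"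

section \<open>Connections on the tangent bundle of \<open>V\<close>\<close>

text \<open>A connection \<open>(X, Y) \<mapsto> \<nabla>\<^sub>XY\<close> is an operator \<open>D X Y\<close> on smooth
  vector fields; its values on maps that are not smooth are irrelevant.\<close>

type_synonym 'a conn = "('a \<Rightarrow> 'a) \<Rightarrow> ('a \<Rightarrow> 'a) \<Rightarrow> ('a \<Rightarrow> 'a)"

definition connection :: "'a::euclidean_space conn \<Rightarrow> bool" where
  "connection D \<longleftrightarrow>
     (\<forall>X Y. smooth X \<longrightarrow> smooth Y \<longrightarrow> smooth (D X Y)) \<and>
     (\<forall>X X' Y. smooth X \<longrightarrow> smooth X' \<longrightarrow> smooth Y \<longrightarrow>
        (\<forall>p. D (\<lambda>q. X q + X' q) Y p = D X Y p + D X' Y p)) \<and>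
     (\<forall>f X Y. smooth (f :: 'a \<Rightarrow> real) \<longrightarrow> smooth X \<longrightarrow> smooth Y \<longrightarrow>
        (\<forall>p. D (\<lambda>q. f q *\<^sub>R X q) Y p = f p *\<^sub>R D X Y p)) \<and>
     (\<forall>X Y Y'. smooth X \<longrightarrow> smooth Y \<longrightarrow> smooth Y' \<longrightarrow>
        (\<forall>p. D X (\<lambda>q. Y q + Y' q) p = D X Y p + D X Y' p)) \<and>
     (\<forall>f X Y. smooth (f :: 'a \<Rightarrow> real) \<longrightarrow> smooth X \<longrightarrow> smooth Y \<longrightarrow>
        (\<forall>p. D X (\<lambda>q. f q *\<^sub>R Y q) p =
               frechet_derivative f (at p) (X p) *\<^sub>R Y p + f p *\<^sub>R D X Y p))"

definition torsion_free :: "'a::euclidean_space conn \<Rightarrow> bool" where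
  "torsion_free D \<longleftrightarrow>
     (\<forall>X Y. smooth X \<longrightarrow> smooth Y \<longrightarrow> (\<forall>p. D X Y p - D Y X p = lie_bracket X Y p))"

definition curvature :: "'a::euclidean_space conn \<Rightarrow>
    ('a \<Rightarrow> 'a) \<Rightarrow> ('a \<Rightarrow> 'a) \<Rightarrow> ('a \<Rightarrow> 'a) \<Rightarrow> ('a \<Rightarrow> 'a)" where
  "curvature D X Y Z p =
     D X (D Y Z) p - D Y (D X Z) p - D (lie_bracket X Y) Z p"

text \<open>The value \<open>\<R>\<^sub>p\<close> of the curvature operator at the point \<open>p\<close> is \<open>A\<close>.  Quantifying over all smooth
  extensions of the tangent vectors avoids any choice of extension, and determines \<open>A\<close>.\<close>

definition has_curvature_at :: "'a::euclidean_space conn \<Rightarrow> 'a \<Rightarrow> 'a curvop \<Rightarrow> bool" where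
  "has_curvature_at D p A \<longleftrightarrow>
     (\<forall>X Y Z. smooth X \<longrightarrow> smooth Y \<longrightarrow> smooth Z \<longrightarrow>
        curvature D X Y Z p = A (X p) (Y p) (Z p))"

definition flat_connection :: "'a::euclidean_space conn \<Rightarrow> bool" where
  "flat_connection D \<longleftrightarrow>
     (\<forall>X Y Z. smooth X \<longrightarrow> smooth Y \<longrightarrow> smooth Z \<longrightarrow> (\<forall>p. curvature D X Y Z p = 0))"

definition smooth_one_form :: "('a::euclidean_space \<Rightarrow> 'a \<Rightarrow> real) \<Rightarrow> bool" where
  "smooth_one_form \<theta> \<longleftrightarrow> (\<forall>p. linear (\<theta> p)) \<and> (\<forall>v. smooth (\<lambda>p. \<theta> p v))"

definition projectively_equivalent ::
    "'a::euclidean_space conn \<Rightarrow> 'a conn \<Rightarrow> bool" where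
  "projectively_equivalent D D' \<longleftrightarrow>
     (\<exists>\<theta>. smooth_one_form \<theta> \<and>
        (\<forall>X Y. smooth X \<longrightarrow> smooth Y \<longrightarrow>
           (\<forall>p. D X Y p - D' X Y p = \<theta> p (X p) *\<^sub>R Y p + \<theta> p (Y p) *\<^sub>R X p)))"

definition projectively_flat_connection :: "'a::euclidean_space conn \<Rightarrow> bool" where
  "projectively_flat_connection D \<longleftrightarrow>
     (\<exists>D'. connection D' \<and> torsion_free D' \<and> flat_connection D' \<and>
        projectively_equivalent D D')"

section \<open>Parallel volume forms\<close>

text \<open>An alternating \<open>k\<close>-form is a function on lists; only its values on lists of length \<open>k\<close> matter.\<close>

definition alternating_form :: "nat \<Rightarrow> ('a::euclidean_space list \<Rightarrow> real) \<Rightarrow> bool" where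
  "alternating_form k \<omega> \<longleftrightarrow>
     (\<forall>vs i. length vs = k \<longrightarrow> i < k \<longrightarrow> linear (\<lambda>v. \<omega> (vs[i := v]))) \<and>
     (\<forall>vs i j. length vs = k \<longrightarrow> i < j \<longrightarrow> j < k \<longrightarrow> vs ! i = vs ! j \<longrightarrow> \<omega> vs = 0)"

definition volume_form_on :: "'a::euclidean_space set \<Rightarrow> ('a \<Rightarrow> 'a list \<Rightarrow> real) \<Rightarrow> bool" where
  "volume_form_on U \<Omega> \<longleftrightarrow>
     (\<forall>p\<in>U. alternating_form DIM('a) (\<Omega> p)) \<and>
     (\<forall>vs. length vs = DIM('a) \<longrightarrow> smooth_on (\<lambda>p. \<Omega> p vs) U) \<and>
     (\<forall>p\<in>U. \<exists>vs. length vs = DIM('a) \<and> \<Omega> p vs \<noteq> 0)"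

text \<open>\<open>(\<nabla>\<^sub>X\<Omega>)(Y\<^sub>1,\<dots>,Y\<^sub>m) = X(\<Omega>(Y\<^sub>1,\<dots>,Y\<^sub>m)) - \<Sum>\<^sub>i \<Omega>(Y\<^sub>1,\<dots>,\<nabla>\<^sub>XY\<^sub>i,\<dots>,Y\<^sub>m)\<close>\<close>

definition nabla_form :: "'a::euclidean_space conn \<Rightarrow> ('a \<Rightarrow> 'a) \<Rightarrow>
    ('a \<Rightarrow> 'a list \<Rightarrow> real) \<Rightarrow> ('a \<Rightarrow> 'a) list \<Rightarrow> 'a \<Rightarrow> real" where
  "nabla_form D X \<Omega> Ys p =
     frechet_derivative (\<lambda>q. \<Omega> q (map (\<lambda>Y. Y q) Ys)) (at p) (X p)
     - (\<Sum>i<length Ys. \<Omega> p (map (\<lambda>Y. Y p) (Ys[i := D X (Ys ! i)])))"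

text \<open>Testing \<open>\<nabla>\<Omega> = 0\<close> on \<open>U\<close> against global vector fields is no restriction, because \<open>\<nabla>\<Omega>\<close> is
  tensorial and every tangent vector extends to a global field.\<close>

definition parallel_on ::
    "'a::euclidean_space conn \<Rightarrow> 'a set \<Rightarrow> ('a \<Rightarrow> 'a list \<Rightarrow> real) \<Rightarrow> bool" where
  "parallel_on D U \<Omega> \<longleftrightarrow>
     (\<forall>X Ys. smooth X \<longrightarrow> length Ys = DIM('a) \<longrightarrow> (\<forall>Y\<in>set Ys. smooth Y) \<longrightarrow>
        (\<forall>p\<in>U. nabla_form D X \<Omega> Ys p = 0))"

definition equiaffine_connection :: "'a::euclidean_space conn \<Rightarrow> bool" where
  "equiaffine_connection D \<longleftrightarrow>
     (\<forall>p. \<exists>U \<Omega>. open U \<and> p \<in> U \<and> volume_form_on U \<Omega> \<and> parallel_on D U \<Omega>)"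

end

theory Submission
  imports Defs
begin

text \<open>Projective flatness says \<open>A(x,y)z = \<beta>(x,z)y - \<beta>(y,z)x\<close> for the symmetric form \<open>\<beta> = -\<rho>/(m-1)\<close>.
  Change the flat connection of \<open>V\<close> projectively by the one-form \<open>\<theta>\<^sub>p(v) = \<beta>(p,v)\<close>: as \<open>\<theta>\<close> is linear in
  \<open>p\<close> and vanishes at the origin, only its derivative, which is \<open>\<beta>\<close> again, contributes to the curvature there,
  and this gives \<open>A\<close>. By symmetry of \<open>\<beta>\<close> the form \<open>\<theta>\<close> is the differential of \<open>p \<mapsto> \<beta>(p,p)/2\<close>, so that
  \<open>exp((m+1)\<beta>(p,p)/2)\<close> times the determinant is a parallel volume form.\<close>

section \<open>Smooth maps and symmetry of second derivatives\<close>

lemma frechet_derivative_eqI: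
  "(f has_derivative f') (at p) \<Longrightarrow> frechet_derivative f (at p) = f'"
  using frechet_derivative_at by metis

text \<open>The recursion for class \<open>Suc n\<close> speaks only of derivatives of class
  \<open>n\<close>, so lower regularity has to be recovered by induction; the base case is
  continuity of differentiable maps.\<close>

lemma Ck_on_Suc_imp: "Ck_on (Suc n) f UNIV \<Longrightarrow> Ck_on n f UNIV"
proof (induction n arbitrary: f)
  case 0
  then show ?case
    by (auto intro!: differentiable_imp_continuous_on simp: differentiable_on_def)
next
  case (Suc n)
  have "Ck_on n (\<lambda>p. frechet_derivative f (at p) v) UNIV" for v
    using Suc.prems by (intro Suc.IH) auto
  with Suc.prems show ?case by simp
qed

lemma Ck_on_const: "Ck_on n (\<lambda>p. c) UNIV"
  by (induction n arbitrary: c) auto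

lemma Ck_on_add:
  "Ck_on n f UNIV \<Longrightarrow> Ck_on n g UNIV \<Longrightarrow> Ck_on n (\<lambda>p. f p + g p) UNIV"
proof (induction n arbitrary: f g)
  case 0
  then show ?case by (auto intro: continuous_intros)
next
  case (Suc n)
  have "frechet_derivative (\<lambda>p. f p + g p) (at p) v =
      frechet_derivative f (at p) v + frechet_derivative g (at p) v" for p v
    using Suc.prems
    by (subst frechet_derivative_eqI[OF has_derivative_add])
       (auto simp: frechet_derivative_works[symmetric])
  with Suc show ?case by auto
qed

text \<open>The product rule writes the derivative as two products of the same kind, each with one
  differentiated factor; the other factor is lowered by one class so that the induction hypothesis
  applies.\<close>

lemma Ck_on_bilinear:
  assumes "bounded_bilinear mul"
  shows "Ck_on n f UNIV \<Longrightarrow> Ck_on n g UNIV \<Longrightarrow> Ck_on n (\<lambda>p. mul (f p) (g p)) UNIV"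
proof (induction n arbitrary: f g)
  case 0
  then show ?case by (auto intro: bounded_bilinear.continuous_on[OF assms])
next
  case (Suc n)
  have d: "((\<lambda>p. mul (f p) (g p)) has_derivative (\<lambda>v. mul (f p) (frechet_derivative g (at p) v)
       + mul (frechet_derivative f (at p) v) (g p))) (at p)" for p
    using Suc.prems
    by (intro bounded_bilinear.FDERIV[OF assms]) (auto simp: frechet_derivative_works[symmetric])
  have "Ck_on n (\<lambda>p. mul (f p) (frechet_derivative g (at p) v)
       + mul (frechet_derivative f (at p) v) (g p)) UNIV" for v
    using Suc.prems Suc.IH Ck_on_Suc_imp[OF Suc.prems(1)] Ck_on_Suc_imp[OF Suc.prems(2)]
    by (intro Ck_on_add) auto
  then show ?case
    using d by (auto simp: frechet_derivative_eqI[OF d] intro: differentiableI)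
qed

lemma smoothD:
  assumes "smooth f"
  shows smooth_has_derivative: "(f has_derivative frechet_derivative f (at p)) (at p)"
    and smooth_differentiable: "f differentiable (at p)"
    and smooth_frechet_derivative: "smooth (\<lambda>q. frechet_derivative f (at q) v)"
    and smooth_continuous_on: "continuous_on UNIV f"
proof -
  have "Ck_on (Suc n) f UNIV" for n
    using assms unfolding smooth_on_def by blast
  then show "f differentiable (at p)" "smooth (\<lambda>q. frechet_derivative f (at q) v)"
    by (auto simp: smooth_on_def)
  then show "(f has_derivative frechet_derivative f (at p)) (at p)"
    by (simp add: frechet_derivative_works)
  show "continuous_on UNIV f"
    using assms unfolding smooth_on_def by (metis Ck_on.simps(1))
qed

lemma smooth_linear_frechet_derivative:
  "smooth f \<Longrightarrow> linear (frechet_derivative f (at p))"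
  using smooth_has_derivative has_derivative_linear by blast

lemma smooth_const: "smooth (\<lambda>p. c)"
  by (simp add: smooth_on_def Ck_on_const)

lemma smooth_add: "smooth f \<Longrightarrow> smooth g \<Longrightarrow> smooth (\<lambda>p. f p + g p)"
  by (simp add: smooth_on_def Ck_on_add)

lemma smooth_bilinear:
  "bounded_bilinear mul \<Longrightarrow> smooth f \<Longrightarrow> smooth g \<Longrightarrow> smooth (\<lambda>p. mul (f p) (g p))"
  by (simp add: smooth_on_def Ck_on_bilinear)

lemmas smooth_scaleR = smooth_bilinear[OF bounded_bilinear_scaleR]
  and smooth_inner = smooth_bilinear[OF bounded_bilinear_inner]

lemma smooth_sum: "(\<And>i. i \<in> I \<Longrightarrow> smooth (f i)) \<Longrightarrow> smooth (\<lambda>p. \<Sum>i\<in>I. f i p)"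
  by (induction I rule: infinite_finite_induct) (auto intro: smooth_const smooth_add)

lemma smooth_bounded_linear: "bounded_linear f \<Longrightarrow> smooth f"
proof -
  assume f: "bounded_linear f"
  have "frechet_derivative f (at p) = f" for p
    by (intro frechet_derivative_eqI bounded_linear_imp_has_derivative f)
  then have "Ck_on n f UNIV" for n
    by (cases n)
       (auto simp: Ck_on_const f bounded_linear_imp_differentiable
         intro: linear_continuous_on)
  then show ?thesis by (simp add: smooth_on_def)
qed

lemma smooth_linear:
  fixes f :: "'a::euclidean_space \<Rightarrow> 'b::real_normed_vector"
  shows "linear f \<Longrightarrow> smooth f"
  by (intro smooth_bounded_linear) (simp add: linear_conv_bounded_linear)

text \<open>The derivative is again \<open>exp (f p)\<close> times a smooth factor, so each
  induction step reduces to a product with the previous class.\<close>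

lemma smooth_exp:
  fixes f :: "'a::euclidean_space \<Rightarrow> real"
  assumes "smooth f"
  shows "smooth (\<lambda>p. exp (f p))"
proof -
  have d: "((\<lambda>p. exp (f p)) has_derivative (\<lambda>v. exp (f p) * frechet_derivative f (at p) v)) (at p)"
    for p
    using has_derivative_exp[OF smooth_has_derivative[OF assms]] by (simp add: mult.commute)
  have "Ck_on n (\<lambda>p. exp (f p)) UNIV" for n
  proof (induction n)
    case 0
    show ?case using assms smooth_continuous_on by (auto intro!: continuous_intros)
  next
    case (Suc n)
    have "Ck_on n (\<lambda>p. exp (f p) * frechet_derivative f (at p) v) UNIV" for v
      using smooth_frechet_derivative[OF assms, of v] Suc
      by (intro Ck_on_bilinear[OF bounded_bilinear_mult]) (auto simp: smooth_on_def)
    then show ?case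
      using d by (auto simp: frechet_derivative_eqI[OF d] intro: differentiableI)
  qed
  then show ?thesis by (simp add: smooth_on_def)
qed

section \<open>Families of linear maps applied to vector fields\<close>

lemma linear_euclidean_expansion:
  fixes L :: "'a::euclidean_space \<Rightarrow> 'b::real_vector"
  assumes "linear L"
  shows "L x = (\<Sum>b\<in>Basis. (x \<bullet> b) *\<^sub>R L b)"
  by (subst euclidean_representation[of x, symmetric])
     (simp only: linear_sum[OF assms] linear_cmul[OF assms])

text \<open>Expanding the argument in \<open>Basis\<close> leaves a finite sum of products of smooth
  functions, so smoothness of \<open>L p v\<close> for each fixed vector \<open>v\<close>
  suffices.\<close>

lemma smooth_apply_linear:
  fixes L :: "'a::euclidean_space \<Rightarrow> 'c::euclidean_space \<Rightarrow> 'b::real_normed_vector"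
  assumes "\<And>p. linear (L p)" and "\<And>v. smooth (\<lambda>p. L p v)" and "smooth X"
  shows "smooth (\<lambda>p. L p (X p))"
proof -
  have "smooth (\<lambda>p. \<Sum>b\<in>Basis. (X p \<bullet> b) *\<^sub>R L p b)"
    by (intro smooth_sum smooth_scaleR smooth_inner assms smooth_const)
  moreover have "(\<lambda>p. L p (X p)) = (\<lambda>p. \<Sum>b\<in>Basis. (X p \<bullet> b) *\<^sub>R L p b)"
    by (intro ext linear_euclidean_expansion assms)
  ultimately show ?thesis by simp
qed

lemma has_derivative_apply_linear:
  fixes L :: "'a::euclidean_space \<Rightarrow> 'c::euclidean_space \<Rightarrow> 'b::real_normed_vector"
  assumes L: "\<And>p. linear (L p)" "\<And>v. smooth (\<lambda>p. L p v)" and X: "smooth X"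
  shows "((\<lambda>p. L p (X p)) has_derivative
    (\<lambda>v. frechet_derivative (\<lambda>q. L q (X p)) (at p) v + L p (frechet_derivative X (at p) v))) (at p)"
proof -
  have e: "L q x = (\<Sum>b\<in>Basis. (x \<bullet> b) *\<^sub>R L q b)" for q x
    using linear_euclidean_expansion[OF L(1)] .
  \<comment> \<open>Stated for a general field because it is used twice: for \<open>X\<close>, and
    for the constant field with value \<open>X p\<close>, which identifies the term where only
    \<open>L\<close> is differentiated.\<close>
  have d: "((\<lambda>q. \<Sum>b\<in>Basis. (Y q \<bullet> b) *\<^sub>R L q b) has_derivative (\<lambda>v. \<Sum>b\<in>Basis.
     (Y p \<bullet> b) *\<^sub>R frechet_derivative (\<lambda>q. L q b) (at p) v
     + (frechet_derivative Y (at p) v \<bullet> b) *\<^sub>R L p b)) (at p)" if "smooth Y" for Y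
    using smooth_has_derivative[OF that, of p] smooth_has_derivative[OF L(2)]
    by (intro has_derivative_sum has_derivative_scaleR has_derivative_inner_left)
  have 1: "frechet_derivative (\<lambda>q. L q (X p)) (at p) =
      (\<lambda>v. \<Sum>b\<in>Basis. (X p \<bullet> b) *\<^sub>R frechet_derivative (\<lambda>q. L q b) (at p) v)"
    using frechet_derivative_eqI[OF d[OF smooth_const[of "X p"]]] by (simp flip: e)
  show ?thesis
    using d[OF X] unfolding 1 by (simp add: sum.distrib flip: e)
qed

section \<open>Equality of mixed second derivatives\<close>

lemma second_difference_mvt:
  fixes f :: "'a::euclidean_space \<Rightarrow> real"
  assumes f: "smooth f" and h: "h > 0"
  shows "\<exists>s t. 0 < s \<and> s < h \<and> 0 < t \<and> t < h \<and>
     f (p + h *\<^sub>R u + h *\<^sub>R v) - f (p + h *\<^sub>R u) - f (p + h *\<^sub>R v) + f p =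
     h * h * frechet_derivative (\<lambda>q. frechet_derivative f (at q) u) (at (p + s *\<^sub>R u + t *\<^sub>R v)) v"
proof -
  have line: "((\<lambda>s. g (q + s *\<^sub>R w)) has_real_derivative frechet_derivative g (at (q + s *\<^sub>R w)) w) (at s)"
    if g: "smooth g" for g :: "'a \<Rightarrow> real" and q w s
  proof -
    have "((\<lambda>s. q + s *\<^sub>R w) has_derivative (\<lambda>r. r *\<^sub>R w)) (at s)"
      by (auto intro!: derivative_eq_intros)
    from has_derivative_compose[OF this smooth_has_derivative[OF g]]
    show ?thesis
      by (simp add: has_field_derivative_def mult.commute[of _ "_ w"] fun_eq_iff
        linear_cmul[OF smooth_linear_frechet_derivative[OF g]])
  qed
  let ?f' = "\<lambda>q. frechet_derivative f (at q) u"
  \<comment> \<open>The increment of this function from \<open>0\<close> to \<open>h\<close> is the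
    second difference. The mean value theorem thus applies first along \<open>u\<close>, and then
    along \<open>v\<close> to the derivative in direction \<open>u\<close>.\<close>
  have "((\<lambda>s. f (p + h *\<^sub>R v + s *\<^sub>R u) - f (p + s *\<^sub>R u)) has_real_derivative
     ?f' (p + h *\<^sub>R v + s *\<^sub>R u) - ?f' (p + s *\<^sub>R u)) (at s)" for s
    by (intro DERIV_diff line f)
  from MVT2[OF h this] obtain s where s: "0 < s" "s < h"
    and 1: "f (p + h *\<^sub>R v + h *\<^sub>R u) - f (p + h *\<^sub>R u) - (f (p + h *\<^sub>R v) - f p) =
      h * (?f' (p + h *\<^sub>R v + s *\<^sub>R u) - ?f' (p + s *\<^sub>R u))"
    by auto
  from MVT2[OF h line[OF smooth_frechet_derivative[OF f]], of "p + s *\<^sub>R u" v u]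
  obtain t where t: "0 < t" "t < h" and 2: "?f' (p + s *\<^sub>R u + h *\<^sub>R v) - ?f' (p + s *\<^sub>R u) =
      h * frechet_derivative ?f' (at (p + s *\<^sub>R u + t *\<^sub>R v)) v"
    by auto
  show ?thesis
    using 1 2 s t by (intro exI[of _ s] exI[of _ t]) (simp add: algebra_simps)
qed

text \<open>The second difference is symmetric in \<open>u\<close> and \<open>v\<close>. Divided by
  the square of the step it tends to either mixed derivative, since the intermediate points converge
  to \<open>p\<close> and second derivatives are continuous.\<close>

lemma second_derivative_symmetric_real:
  fixes f :: "'a::euclidean_space \<Rightarrow> real"
  assumes f: "smooth f"
  shows "frechet_derivative (\<lambda>q. frechet_derivative f (at q) u) (at p) v =
         frechet_derivative (\<lambda>q. frechet_derivative f (at q) v) (at p) u"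
proof -
  define h where "h n = inverse (real (Suc n))" for n
  have h: "h n > 0" for n by (simp add: h_def)
  have h0: "h \<longlonglongrightarrow> 0" unfolding h_def by (rule LIMSEQ_inverse_real_of_nat)
  let ?D = "\<lambda>u v q. frechet_derivative (\<lambda>q. frechet_derivative f (at q) u) (at q) v"
  let ?\<Delta> = "\<lambda>n u v. f (p + h n *\<^sub>R u + h n *\<^sub>R v) - f (p + h n *\<^sub>R u) - f (p + h n *\<^sub>R v) + f p"
  have lim: "(\<lambda>n. ?\<Delta> n u v / (h n * h n)) \<longlonglongrightarrow> ?D u v p" for u v
  proof -
    have "\<forall>n. \<exists>s t. 0 < s \<and> s < h n \<and> 0 < t \<and> t < h n \<and>
        ?\<Delta> n u v = h n * h n * ?D u v (p + s *\<^sub>R u + t *\<^sub>R v)"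
      using second_difference_mvt[OF f h] by blast
    then obtain s t where st: "\<And>n. 0 < s n" "\<And>n. s n < h n" "\<And>n. 0 < t n" "\<And>n. t n < h n"
      and eq: "\<And>n. ?\<Delta> n u v = h n * h n * ?D u v (p + s n *\<^sub>R u + t n *\<^sub>R v)"
      by metis
    have "s \<longlonglongrightarrow> 0" "t \<longlonglongrightarrow> 0"
      using st by (auto intro!: tendsto_sandwich[OF _ _ tendsto_const h0] always_eventually less_imp_le)
    then have "(\<lambda>n. p + s n *\<^sub>R u + t n *\<^sub>R v) \<longlonglongrightarrow> p + 0 *\<^sub>R u + 0 *\<^sub>R v"
      by (intro tendsto_intros)
    then have "(\<lambda>n. ?D u v (p + s n *\<^sub>R u + t n *\<^sub>R v)) \<longlonglongrightarrow> ?D u v p"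
      using continuous_on_tendsto_compose[OF smooth_continuous_on[OF smooth_frechet_derivative[OF
            smooth_frechet_derivative[OF f]]]]
      by simp
    moreover have "h n \<noteq> 0" for n using h[of n] by simp
    ultimately show ?thesis unfolding eq by simp
  qed
  have "(\<lambda>n. ?\<Delta> n v u / (h n * h n)) = (\<lambda>n. ?\<Delta> n u v / (h n * h n))"
    by (simp add: algebra_simps)
  from LIMSEQ_unique[OF lim[of u v] lim[of v u, unfolded this]] show ?thesis .
qed

lemma second_derivative_symmetric:
  fixes f :: "'a::euclidean_space \<Rightarrow> 'b::euclidean_space"
  assumes f: "smooth f"
  shows "frechet_derivative (\<lambda>q. frechet_derivative f (at q) u) (at p) v =
         frechet_derivative (\<lambda>q. frechet_derivative f (at q) v) (at p) u"
proof (rule euclidean_eqI)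
  fix b :: 'b
  have comp: "frechet_derivative (\<lambda>q. g q \<bullet> b) (at p) w = frechet_derivative g (at p) w \<bullet> b"
    if "smooth g" for g :: "'a \<Rightarrow> 'b" and w p
    using frechet_derivative_eqI[OF has_derivative_inner_left[OF smooth_has_derivative[OF that], of b]]
    by simp
  have "smooth (\<lambda>q. f q \<bullet> b)" by (intro smooth_inner f smooth_const)
  from second_derivative_symmetric_real[OF this]
  show "frechet_derivative (\<lambda>q. frechet_derivative f (at q) u) (at p) v \<bullet> b =
         frechet_derivative (\<lambda>q. frechet_derivative f (at q) v) (at p) u \<bullet> b"
    by (simp add: comp f smooth_frechet_derivative)
qed

section \<open>The standard volume form\<close>

definition basis_list :: "'a::euclidean_space list" where
  "basis_list = (SOME bs. distinct bs \<and> set bs = Basis)"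

lemma distinct_basis_list: "distinct (basis_list :: 'a::euclidean_space list)"
  and set_basis_list: "set (basis_list :: 'a list) = Basis"
proof -
  have "\<exists>bs. distinct bs \<and> set bs = (Basis :: 'a set)"
    using finite_distinct_list[OF finite_Basis] by metis
  then have "distinct (basis_list :: 'a list) \<and> set (basis_list :: 'a list) = Basis"
    unfolding basis_list_def by (rule someI_ex)
  then show "distinct (basis_list :: 'a list)" "set (basis_list :: 'a list) = Basis" by auto
qed

lemma length_basis_list: "length (basis_list :: 'a::euclidean_space list) = DIM('a)"
  by (metis distinct_basis_list distinct_card set_basis_list)

text \<open>The library determinant is tied to index types, so the volume form of a type
  of class \<open>euclidean_space\<close> is given by the Leibniz formula in a chosen ordering of \<open>Basis\<close>.\<close>

definition basis_det :: "'a::euclidean_space list \<Rightarrow> real" where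
  "basis_det vs = (\<Sum>\<pi> | \<pi> permutes {..<DIM('a)}.
     of_int (sign \<pi>) * (\<Prod>i<DIM('a). vs ! i \<bullet> basis_list ! \<pi> i))"

text \<open>Isolates the single factor that depends on slot \<open>i\<close>. Both linearity in a
  slot and the derivative of the determinant are read off from this form.\<close>

lemma basis_det_list_update:
  fixes vs :: "'a::euclidean_space list"
  assumes "length vs = DIM('a)" "i < DIM('a)"
  shows "basis_det (vs[i := v]) = (\<Sum>\<pi> | \<pi> permutes {..<DIM('a)}.
     of_int (sign \<pi>) * ((v \<bullet> basis_list ! \<pi> i) *
       (\<Prod>k\<in>{..<DIM('a)} - {i}. vs ! k \<bullet> basis_list ! \<pi> k)))"
proof -
  have "(\<Prod>k<DIM('a). vs[i := v] ! k \<bullet> basis_list ! \<pi> k) =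
      (v \<bullet> basis_list ! \<pi> i) * (\<Prod>k\<in>{..<DIM('a)} - {i}. vs ! k \<bullet> basis_list ! \<pi> k)" for \<pi>
    using assms by (subst prod.remove[of _ i]) (auto intro!: prod.cong)
  then show ?thesis by (simp add: basis_det_def)
qed

text \<open>Composition with the transposition of \<open>i\<close> and \<open>j\<close> reverses the
  sign of a permutation and preserves its product, so the sum equals its own negative.\<close>

lemma basis_det_identical:
  fixes vs :: "'a::euclidean_space list"
  assumes "i < DIM('a)" "j < DIM('a)" "i \<noteq> j" "vs ! i = vs ! j"
  shows "basis_det vs = 0"
proof -
  let ?m = "DIM('a)"
  let ?t = "Transposition.transpose i j"
  let ?f = "\<lambda>\<pi>. of_int (sign \<pi>) * (\<Prod>k<?m. vs ! k \<bullet> basis_list ! \<pi> k) :: real"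
  have t: "?t permutes {..<?m}" using assms by (intro permutes_swap_id) auto
  have "?f (\<pi> \<circ> ?t) = - ?f \<pi>" if "\<pi> permutes {..<?m}" for \<pi>
  proof -
    have "sign (\<pi> \<circ> ?t) = - sign \<pi>"
      using that assms(3) permutation_permutes[of \<pi>]
      by (subst sign_compose) (auto simp: permutation_swap_id sign_swap_id)
    \<comment> \<open>Reindexing by the transposition cancels it inside the permutation and moves it
      to the entries of \<open>vs\<close>, where it has no effect because entries \<open>i\<close>
      and \<open>j\<close> agree.\<close>
    moreover have "(\<Prod>k<?m. vs ! k \<bullet> basis_list ! (\<pi> \<circ> ?t) k) =
        (\<Prod>k<?m. vs ! ?t k \<bullet> basis_list ! (\<pi> \<circ> ?t) (?t k))"
      by (subst prod.permute[OF t]) (simp add: o_def)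
    moreover have "vs ! ?t k = vs ! k" for k
      using assms(4) by (auto simp: Transposition.transpose_def)
    ultimately show ?thesis by simp
  qed
  then have "basis_det vs = - basis_det vs"
    unfolding basis_det_def
    by (subst sum_permutations_compose_right[OF t]) (simp add: sum_negf)
  then show ?thesis by simp
qed

lemma alternating_form_basis_det: "alternating_form DIM('a::euclidean_space) (basis_det :: 'a list \<Rightarrow> real)"
proof -
  have "linear (\<lambda>v. basis_det (vs[i := v]))"
    if "length vs = DIM('a)" "i < DIM('a)" for vs :: "'a list" and i
    by (rule linearI)
       (simp_all add: basis_det_list_update that inner_add_left distrib_left distrib_right
          sum.distrib sum_distrib_left mult_ac)
  then show ?thesis
    unfolding alternating_form_def
    by (metis basis_det_identical less_trans nat_neq_iff)
qed

text \<open>Orthonormality kills every summand except the identity: any other permutation moves some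
  index, which gives a zero factor. This makes the volume form nowhere vanishing.\<close>

lemma basis_det_basis_list: "basis_det (basis_list :: 'a::euclidean_space list) = 1"
proof -
  let ?m = "DIM('a)"
  let ?b = "basis_list :: 'a list"
  have ip: "?b ! i \<bullet> ?b ! j = (if i = j then 1 else 0)" if "i < ?m" "j < ?m" for i j
    using that nth_mem[of i ?b] nth_mem[of j ?b]
    by (auto simp: length_basis_list set_basis_list inner_Basis
        nth_eq_iff_index_eq[OF distinct_basis_list])
  have "(\<Prod>i<?m. ?b ! i \<bullet> ?b ! \<pi> i) = 0" if p: "\<pi> permutes {..<?m}" and "\<pi> \<noteq> id" for \<pi>
  proof -
    obtain i where i: "\<pi> i \<noteq> i" using \<open>\<pi> \<noteq> id\<close> by (metis eq_id_iff)
    then have "i < ?m" using p by (metis lessThan_iff permutes_not_in)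
    moreover then have "\<pi> i < ?m" using permutes_in_image[OF p] by simp
    ultimately have "?b ! i \<bullet> ?b ! \<pi> i = 0"
      using i ip[of i "\<pi> i"] by simp
    with \<open>i < ?m\<close> show ?thesis by (intro prod_zero) auto
  qed
  then have "basis_det ?b = (\<Sum>\<pi>\<in>{id}. of_int (sign \<pi>) * (\<Prod>i<?m. ?b ! i \<bullet> ?b ! \<pi> i))"
    unfolding basis_det_def
    by (intro sum.mono_neutral_right) (auto simp: permutes_id finite_permutations)
  then show ?thesis by (simp add: ip)
qed

text \<open>The product rule in each Leibniz summand differentiates one factor at a time; exchanging
  the two sums collects, for each slot, a determinant with that slot replaced.\<close>

lemma has_derivative_basis_det:
  fixes Ys :: "('b::real_normed_vector \<Rightarrow> 'a::euclidean_space) list"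
  assumes len: "length Ys = DIM('a)"
    and Y: "\<And>i. i < DIM('a) \<Longrightarrow> (Ys ! i has_derivative Y' i) (at p)"
  shows "((\<lambda>q. basis_det (map (\<lambda>Y. Y q) Ys)) has_derivative
    (\<lambda>h. \<Sum>i<DIM('a). basis_det ((map (\<lambda>Y. Y p) Ys)[i := Y' i h]))) (at p)"
proof -
  let ?m = "DIM('a)"
  have eq: "basis_det (map (\<lambda>Y. Y q) Ys) = (\<Sum>\<pi> | \<pi> permutes {..<?m}.
      of_int (sign \<pi>) * (\<Prod>i<?m. (Ys ! i) q \<bullet> basis_list ! \<pi> i))" for q
    unfolding basis_det_def using len by (intro sum.cong prod.cong refl arg_cong2[where f = "(*)"]) auto
  have "((\<lambda>q. basis_det (map (\<lambda>Y. Y q) Ys)) has_derivative (\<lambda>h. \<Sum>\<pi> | \<pi> permutes {..<?m}.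
      of_int (sign \<pi>) * (\<Sum>i<?m. (Y' i h \<bullet> basis_list ! \<pi> i) *
        (\<Prod>k\<in>{..<?m} - {i}. (Ys ! k) p \<bullet> basis_list ! \<pi> k)))) (at p)"
    unfolding eq
    by (intro has_derivative_sum has_derivative_mult_right has_derivative_prod
        has_derivative_inner_left Y) auto
  moreover have "(\<Sum>i<?m. basis_det ((map (\<lambda>Y. Y p) Ys)[i := Y' i h])) = (\<Sum>\<pi> | \<pi> permutes {..<?m}.
      of_int (sign \<pi>) * (\<Sum>i<?m. (Y' i h \<bullet> basis_list ! \<pi> i) *
        (\<Prod>k\<in>{..<?m} - {i}. (Ys ! k) p \<bullet> basis_list ! \<pi> k)))" for h
    using len
    by (simp add: basis_det_list_update sum_distrib_left sum.swap[of _ "{\<pi>. \<pi> permutes _}"])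
  ultimately show ?thesis by simp
qed

section \<open>Alternating forms and the trace identity\<close>

lemma alternating_form_linear:
  assumes "alternating_form k \<omega>" "length vs = k" "i < k"
  shows "linear (\<lambda>v. \<omega> (vs[i := v]))"
  using assms by (auto simp: alternating_form_def)

lemma alternating_form_zero:
  assumes "alternating_form k \<omega>" "length vs = k" "i < k" "j < k" "i \<noteq> j" "vs ! i = vs ! j"
  shows "\<omega> vs = 0"
  using assms unfolding alternating_form_def by (metis linorder_neqE_nat)

text \<open>Polarisation: expand the vanishing value with \<open>x + y\<close> in both slots; the
  two terms with equal entries vanish as well.\<close>

lemma alternating_form_swap:
  assumes \<omega>: "alternating_form k \<omega>" and l: "length vs = k" "i < k" "j < k" "i \<noteq> j"
  shows "\<omega> (vs[i := x, j := y]) = - \<omega> (vs[i := y, j := x])"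
proof -
  have i: "\<omega> (vs[i := u + v, j := w]) = \<omega> (vs[i := u, j := w]) + \<omega> (vs[i := v, j := w])" for u v w
    using linear_add[OF alternating_form_linear[OF \<omega>, of "vs[j := w]" i]] l
    by (simp add: list_update_swap[of i j])
  have j: "\<omega> (vs[i := w, j := u + v]) = \<omega> (vs[i := w, j := u]) + \<omega> (vs[i := w, j := v])" for u v w
    using linear_add[OF alternating_form_linear[OF \<omega>, of "vs[i := w]" j]] l by simp
  have z: "\<omega> (vs[i := u, j := u]) = 0" for u
    using l by (intro alternating_form_zero[OF \<omega>, of _ i j]) auto
  have "\<omega> (vs[i := x + y, j := x + y]) = 0" by (rule z)
  then show ?thesis using z unfolding i j by simp
qed

lemma linear_mult_left: "linear f \<Longrightarrow> linear (\<lambda>x. f x * (c::real))"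
  and linear_mult_right: "linear f \<Longrightarrow> linear (\<lambda>x. (c::real) * f x)"
  by (auto simp: linear_iff algebra_simps)

text \<open>The difference of the two sides is multilinear in \<open>X\<close> and \<open>vs\<close>. If \<open>vs\<close> spans, it
  suffices to take \<open>X\<close> from \<open>vs\<close>; otherwise some member of \<open>vs\<close> lies in the span of the others,
  and by linearity in that member it suffices to treat a list with a repeated entry.\<close>

lemma alternating_form_rank_one_trace:
  fixes \<omega> :: "'a::euclidean_space list \<Rightarrow> real"
  assumes \<omega>: "alternating_form DIM('a) \<omega>" and vs: "length vs = DIM('a)" and \<theta>: "linear \<theta>"
  shows "(\<Sum>i<DIM('a). \<theta> (vs ! i) * \<omega> (vs[i := X])) = \<theta> X * \<omega> vs"
proof -
  let ?m = "DIM('a)"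
  define F where "F X vs = (\<Sum>i<?m. \<theta> (vs ! i) * \<omega> (vs[i := X])) - \<theta> X * \<omega> vs" for X vs
  have linX: "linear (\<lambda>X. F X us)" if "length us = ?m" for us
    unfolding F_def using that
    by (intro linear_compose_sub linear_compose_sum ballI linear_mult_left linear_mult_right \<theta>
        alternating_form_linear[OF \<omega>]) auto
  have linj: "linear (\<lambda>v. F X (us[j := v]))" if us: "length us = ?m" "j < ?m" for us j
  proof -
    have "linear (\<lambda>v. \<theta> (us[j := v] ! i) * \<omega> (us[j := v, i := X]))" if "i < ?m" for i
    proof (cases "i = j")
      case True
      then show ?thesis using us by (auto intro: linear_mult_left \<theta>)
    next
      case False
      then show ?thesis using us that
        by (auto simp: list_update_swap[of j i] intro!: linear_mult_right alternating_form_linear[OF \<omega>])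
    qed
    then show ?thesis
      unfolding F_def using us
      by (intro linear_compose_sub linear_compose_sum ballI linear_mult_right
          alternating_form_linear[OF \<omega>]) auto
  qed
  have rep: "F X us = 0" if us: "length us = ?m" and jk: "j < ?m" "k < ?m" "j \<noteq> k" "us ! j = us ! k"
    for us j k
  proof -
    \<comment> \<open>Replacing any other slot keeps the equal entries at \<open>j\<close> and
      \<open>k\<close>, so that term vanishes.\<close>
    have "(\<Sum>i<?m. \<theta> (us ! i) * \<omega> (us[i := X])) = (\<Sum>i\<in>{j, k}. \<theta> (us ! i) * \<omega> (us[i := X]))"
      using us jk
      by (intro sum.mono_neutral_right ballI mult_eq_0_iff[THEN iffD2] disjI2
          alternating_form_zero[OF \<omega>, of _ j k]) auto
    \<comment> \<open>As the entries at \<open>j\<close> and \<open>k\<close> coincide, the two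
      surviving lists differ by a swap of these slots, and antisymmetry cancels them.\<close>
    also have "\<dots> = \<theta> (us ! k) * (\<omega> (us[j := X, k := us ! k]) + \<omega> (us[j := us ! k, k := X]))"
    proof -
      have e1: "us[j := X, k := us ! k] = us[j := X]"
        using list_update_swap[OF jk(3), of us X "us ! k"] by simp
      have e2: "us[j := us ! k, k := X] = us[k := X]"
        using list_update_id[of us j] by (simp only: jk(4))
      show ?thesis
        unfolding e1 e2 using jk(3,4) by (simp add: distrib_left)
    qed
    also have "\<dots> = 0"
      using alternating_form_swap[OF \<omega> us jk(1-3), of X "us ! k"] by simp
    finally show ?thesis
      using alternating_form_zero[OF \<omega> us jk] by (simp add: F_def)
  qed
  have "F X vs = 0"
  proof (cases "\<exists>j<?m. vs ! j \<in> span ((!) vs ` ({..<?m} - {j}))")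
    case True
    then obtain j where j: "j < ?m" "vs ! j \<in> span ((!) vs ` ({..<?m} - {j}))" by blast
    \<comment> \<open>The trivial update exposes slot \<open>j\<close> to linearity; each spanning
      vector put there repeats another entry, so \<open>rep\<close> applies.\<close>
    have "F X (vs[j := vs ! j]) = 0"
      using j vs by (intro linear_eq_0_on_span[OF linj[OF vs j(1)] _ j(2)]) (auto intro: rep[of _ j])
    then show ?thesis by simp
  next
    case False
    have inj: "inj_on ((!) vs) {..<?m}"
    proof (rule inj_onI, rule ccontr)
      fix i j assume "i \<in> {..<?m}" "j \<in> {..<?m}" "vs ! i = vs ! j" "i \<noteq> j"
      then have "vs ! j \<in> span ((!) vs ` ({..<?m} - {j}))"
        by (intro span_base image_eqI[of _ _ i]) auto
      with False \<open>j \<in> _\<close> show False by auto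
    qed
    \<comment> \<open>Injectivity turns removal of an index into removal of a vector, the form in
      which dependence is defined.\<close>
    have "(!) vs ` ({..<?m} - {k}) = (!) vs ` {..<?m} - {vs ! k}" if "k < ?m" for k
      using inj_on_image_set_diff[OF inj, of "{..<?m}" "{k}"] that by auto
    with False have "independent ((!) vs ` {..<?m})"
      unfolding dependent_def by auto
    then have "span ((!) vs ` {..<?m}) = UNIV"
      using inj card_ge_dim_independent[of "(!) vs ` {..<?m}" UNIV]
      by (auto simp: card_image)
    then have X: "X \<in> span ((!) vs ` {..<?m})" by simp
    have "F (vs ! k) vs = 0" if "k < ?m" for k
    proof -
      \<comment> \<open>Copying entry \<open>k\<close> into a different slot creates a repetition,
        so only the trivial replacement at \<open>k\<close> contributes.\<close>
      have "(\<Sum>i<?m. \<theta> (vs ! i) * \<omega> (vs[i := vs ! k])) = (\<Sum>i\<in>{k}. \<theta> (vs ! i) * \<omega> (vs[i := vs ! k]))"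
        using vs that
        by (intro sum.mono_neutral_right ballI mult_eq_0_iff[THEN iffD2] disjI2)
           (auto intro: alternating_form_zero[OF \<omega>, of _ _ k])
      then show ?thesis by (simp add: F_def)
    qed
    then show ?thesis
      by (intro linear_eq_0_on_span[OF linX[OF vs] _ X]) auto
  qed
  then show ?thesis by (simp add: F_def)
qed

section \<open>Projective changes of the flat connection\<close>

definition projective_conn :: "('a::euclidean_space \<Rightarrow> 'a \<Rightarrow> real) \<Rightarrow> 'a conn" where
  "projective_conn \<theta> X Y p =
     frechet_derivative Y (at p) (X p) + \<theta> p (X p) *\<^sub>R Y p + \<theta> p (Y p) *\<^sub>R X p"

lemma frechet_derivative_add:
  "smooth f \<Longrightarrow> smooth g \<Longrightarrow> frechet_derivative (\<lambda>q. f q + g q) (at p) v =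
     frechet_derivative f (at p) v + frechet_derivative g (at p) v"
  by (subst frechet_derivative_eqI[OF has_derivative_add]) (rule smooth_has_derivative | simp)+

lemma frechet_derivative_scaleR:
  "smooth f \<Longrightarrow> smooth g \<Longrightarrow> frechet_derivative (\<lambda>q. f q *\<^sub>R g q) (at p) v =
     f p *\<^sub>R frechet_derivative g (at p) v + frechet_derivative f (at p) v *\<^sub>R g p"
  by (subst frechet_derivative_eqI[OF has_derivative_scaleR]) (rule smooth_has_derivative | simp)+

lemma frechet_derivative_apply_linear:
  fixes L :: "'a::euclidean_space \<Rightarrow> 'c::euclidean_space \<Rightarrow> 'b::real_normed_vector"
  assumes "\<And>p. linear (L p)" "\<And>v. smooth (\<lambda>p. L p v)" "smooth X"
  shows "frechet_derivative (\<lambda>q. L q (X q)) (at p) v =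
    frechet_derivative (\<lambda>q. L q (X p)) (at p) v + L p (frechet_derivative X (at p) v)"
  by (rule fun_cong[OF frechet_derivative_eqI[OF has_derivative_apply_linear[OF assms]]])

lemma smooth_directional_derivative:
  fixes Y :: "'a::euclidean_space \<Rightarrow> 'b::real_normed_vector"
  shows "smooth X \<Longrightarrow> smooth Y \<Longrightarrow> smooth (\<lambda>p. frechet_derivative Y (at p) (X p))"
  by (rule smooth_apply_linear[OF smooth_linear_frechet_derivative smooth_frechet_derivative])

lemma smooth_one_form_apply:
  "smooth_one_form \<theta> \<Longrightarrow> smooth X \<Longrightarrow> smooth (\<lambda>p. \<theta> p (X p))"
  unfolding smooth_one_form_def by (rule smooth_apply_linear) auto

lemma smooth_projective_conn:
  assumes "smooth_one_form \<theta>" "smooth X" "smooth Y"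
  shows "smooth (projective_conn \<theta> X Y)"
  unfolding projective_conn_def[abs_def]
  by (intro smooth_add smooth_scaleR smooth_directional_derivative
      smooth_one_form_apply[OF assms(1)] assms)

lemma connection_projective_conn:
  assumes "smooth_one_form \<theta>"
  shows "connection (projective_conn \<theta>)"
proof -
  have \<theta>: "\<theta> p (x + y) = \<theta> p x + \<theta> p y" "\<theta> p (c *\<^sub>R x) = c * \<theta> p x" for p x y c
    using assms by (auto simp: smooth_one_form_def linear_iff)
  have d: "frechet_derivative Y (at p) (x + y) = frechet_derivative Y (at p) x + frechet_derivative Y (at p) y"
    "frechet_derivative Y (at p) (c *\<^sub>R x) = c *\<^sub>R frechet_derivative Y (at p) x"
    if "smooth Y" for Y :: "'a \<Rightarrow> 'a" and p x y c
    using smooth_linear_frechet_derivative[OF that, of p] by (auto simp: linear_iff)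
  show ?thesis
    unfolding connection_def
    using smooth_projective_conn[OF assms]
    by (auto simp: projective_conn_def \<theta> d frechet_derivative_add frechet_derivative_scaleR
        scaleR_add_left scaleR_add_right mult.commute)
qed

text \<open>The terms containing \<theta> are symmetric in the two fields and cancel, leaving the
  commutator of directional derivatives of the fields.\<close>

lemma torsion_free_projective_conn: "torsion_free (projective_conn \<theta>)"
  by (simp add: torsion_free_def projective_conn_def lie_bracket_def)

section \<open>Flatness of the directional derivative and projective flatness\<close>

lemma frechet_derivative_directional:
  fixes Z :: "'a::euclidean_space \<Rightarrow> 'b::euclidean_space"
  assumes "smooth Y" "smooth Z"
  shows "frechet_derivative (\<lambda>q. frechet_derivative Z (at q) (Y q)) (at p) v =
    frechet_derivative (\<lambda>q. frechet_derivative Z (at q) (Y p)) (at p) v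
    + frechet_derivative Z (at p) (frechet_derivative Y (at p) v)"
  by (rule frechet_derivative_apply_linear[OF smooth_linear_frechet_derivative
        smooth_frechet_derivative]) (rule assms)+

text \<open>Second derivatives of \<open>Z\<close> cancel by symmetry; the remaining first-order
  terms combine to the derivative of \<open>Z\<close> along the bracket. This is the vanishing of
  the curvature of the standard connection.\<close>

lemma directional_derivative_commutator:
  fixes Z :: "'a::euclidean_space \<Rightarrow> 'b::euclidean_space"
  assumes "smooth X" "smooth Y" "smooth Z"
  shows "frechet_derivative (\<lambda>q. frechet_derivative Z (at q) (Y q)) (at p) (X p)
    - frechet_derivative (\<lambda>q. frechet_derivative Z (at q) (X q)) (at p) (Y p)
    = frechet_derivative Z (at p) (lie_bracket X Y p)"
  using second_derivative_symmetric[OF assms(3), of "Y p" p "X p"] assms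
  by (simp add: frechet_derivative_directional lie_bracket_def
      linear_diff[OF smooth_linear_frechet_derivative[OF assms(3)]])

lemma flat_projective_conn_zero: "flat_connection (projective_conn (\<lambda>_ _. 0))"
proof -
  have "projective_conn (\<lambda>_ _. 0) X Y = (\<lambda>p. frechet_derivative Y (at p) (X p))"
    for X Y :: "'a \<Rightarrow> 'a"
    by (simp add: projective_conn_def fun_eq_iff)
  then show ?thesis
    by (simp add: flat_connection_def curvature_def directional_derivative_commutator)
qed

text \<open>The standard connection, obtained from the zero one-form, is the flat partner, and
  \<theta> itself witnesses the equivalence.\<close>

lemma projectively_flat_projective_conn:
  assumes "smooth_one_form \<theta>"
  shows "projectively_flat_connection (projective_conn \<theta>)"
proof -
  have "smooth_one_form (\<lambda>_ _. 0 :: real)"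
    by (simp add: smooth_one_form_def smooth_const linear_zero)
  moreover have "projectively_equivalent (projective_conn \<theta>) (projective_conn (\<lambda>_ _. 0))"
    unfolding projectively_equivalent_def projective_conn_def
    using assms by (intro exI[of _ \<theta>]) simp
  ultimately show ?thesis
    unfolding projectively_flat_connection_def
    using connection_projective_conn torsion_free_projective_conn flat_projective_conn_zero
    by blast
qed

text \<open>From here on a bilinear form \<open>\<beta>\<close> is read as the one-form \<open>\<theta>\<^sub>p(v) = \<beta>(p,v)\<close>.\<close>

lemma bilinear_smooth_one_form:
  fixes \<beta> :: "'a::euclidean_space \<Rightarrow> 'a \<Rightarrow> real"
  shows "bilinear \<beta> \<Longrightarrow> smooth_one_form \<beta>"
  by (simp add: smooth_one_form_def bilinear_def smooth_linear)

lemma has_curvature_at_zero_projective_conn: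
  fixes \<beta> :: "'a::euclidean_space \<Rightarrow> 'a \<Rightarrow> real"
  assumes \<beta>: "bilinear \<beta>" and sym: "\<And>x y. \<beta> x y = \<beta> y x"
  shows "has_curvature_at (projective_conn \<beta>) 0 (\<lambda>x y z. \<beta> x z *\<^sub>R y - \<beta> y z *\<^sub>R x)"
proof -
  have lin: "linear (\<beta> p)" "linear (\<lambda>p. \<beta> p v)" for p v
    using \<beta> by (auto simp: bilinear_def)
  have z: "\<beta> 0 v = 0" for v
    using linear_0[OF lin(2)] .
  \<comment> \<open>The term differentiating \<open>Y\<close> carries the factor
    \<open>\<beta> 0\<close> and drops out; the other is the derivative of a linear map in
    \<open>q\<close>, hence that map itself.\<close>
  have dapp: "frechet_derivative (\<lambda>q. \<beta> q (Y q)) (at 0) v = \<beta> v (Y 0)" if "smooth Y" for Y v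
    using frechet_derivative_apply_linear[OF lin(1) smooth_linear[OF lin(2)] that, of 0 v]
      frechet_derivative_eqI[OF linear_imp_has_derivative[OF lin(2)]]
    by (simp add: z)
  have second: "projective_conn \<beta> X (projective_conn \<beta> Y Z) 0 =
      frechet_derivative (\<lambda>q. frechet_derivative Z (at q) (Y q)) (at 0) (X 0)
      + \<beta> (X 0) (Y 0) *\<^sub>R Z 0 + \<beta> (X 0) (Z 0) *\<^sub>R Y 0"
    if s: "smooth Y" "smooth Z" for X Y Z
    unfolding projective_conn_def
    using s smooth_one_form_apply[OF bilinear_smooth_one_form[OF \<beta>]]
    by (simp add: frechet_derivative_add frechet_derivative_scaleR smooth_add smooth_scaleR
        smooth_directional_derivative dapp z)
  show ?thesis
    unfolding has_curvature_at_def curvature_def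
  proof (intro allI impI)
    fix X Y Z :: "'a \<Rightarrow> 'a"
    assume s: "smooth X" "smooth Y" "smooth Z"
    have "projective_conn \<beta> (lie_bracket X Y) Z 0 = frechet_derivative Z (at 0) (lie_bracket X Y 0)"
      by (simp add: projective_conn_def z)
    then show "projective_conn \<beta> X (projective_conn \<beta> Y Z) 0 - projective_conn \<beta> Y (projective_conn \<beta> X Z) 0
       - projective_conn \<beta> (lie_bracket X Y) Z 0 = \<beta> (X 0) (Z 0) *\<^sub>R Y 0 - \<beta> (Y 0) (Z 0) *\<^sub>R X 0"
      \<comment> \<open>The second-order parts cancel against the bracket term, and the multiples of
        \<open>Z 0\<close> cancel by symmetry of \<beta>.\<close>
      using directional_derivative_commutator[OF s, of 0] sym[of "X 0" "Y 0"]
      by (simp add: second s algebra_simps)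
  qed
qed

text \<open>Differentiating \<open>Y\<^sub>i\<close> along \<open>X\<close> is compensated by the flat part of the connection; the remaining terms
  trace \<open>v \<mapsto> \<theta>(X) v + \<theta>(v) X\<close>, which gives \<open>(m + 1) \<theta>(X)\<close>. Hence the exponent.\<close>

lemma equiaffine_projective_conn:
  fixes \<beta> :: "'a::euclidean_space \<Rightarrow> 'a \<Rightarrow> real"
  assumes \<beta>: "bilinear \<beta>" and sym: "\<And>x y. \<beta> x y = \<beta> y x"
  shows "equiaffine_connection (projective_conn \<beta>)"
proof -
  let ?m = "DIM('a)"
  define E where "E p = exp ((real ?m + 1) / 2 * \<beta> p p)" for p
  define \<Omega> where "\<Omega> p vs = E p * basis_det vs" for p and vs :: "'a list"
  have lin: "linear (\<beta> p)" "linear (\<lambda>p. \<beta> p v)" for p v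
    using \<beta> by (auto simp: bilinear_def)
  have bb: "bounded_bilinear \<beta>"
    using \<beta> by (simp add: bilinear_conv_bounded_bilinear)
  have id: "smooth (\<lambda>p::'a. p)" by (rule smooth_linear[OF linear_ident])
  have E: "smooth E"
    unfolding E_def[abs_def]
    using smooth_exp[OF smooth_scaleR[OF smooth_const[of "(real ?m + 1) / 2"]
          smooth_bilinear[OF bb id id]]] by simp
  have dE: "(E has_derivative (\<lambda>v. E p * ((real ?m + 1) * \<beta> p v))) (at p)" for p
  proof -
    have "((\<lambda>p. (real ?m + 1) / 2 * \<beta> p p) has_derivative (\<lambda>v. (real ?m + 1) / 2 * (\<beta> p v + \<beta> v p))) (at p)"
      by (intro has_derivative_mult_right bounded_bilinear.FDERIV[OF bb] has_derivative_ident)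
    \<comment> \<open>Symmetry makes the two halves of the product rule equal, so the logarithm of
      \<open>E\<close> is a potential for \<open>m + 1\<close> times the one-form.\<close>
    moreover have "(real ?m + 1) / 2 * (\<beta> p v + \<beta> v p) = (real ?m + 1) * \<beta> p v" for v
      by (subst sym[of v p]) simp
    ultimately have "((\<lambda>p. (real ?m + 1) / 2 * \<beta> p p) has_derivative (\<lambda>v. (real ?m + 1) * \<beta> p v)) (at p)"
      by simp
    from has_derivative_exp[OF this] show ?thesis
      unfolding E_def[abs_def] by (simp only: mult.commute)
  qed
  have volume: "volume_form_on UNIV \<Omega>"
  proof -
    have "alternating_form ?m (\<Omega> p)" for p
      using alternating_form_basis_det[where 'a = 'a]
      unfolding alternating_form_def \<Omega>_def by (auto intro: linear_mult_right)
    moreover have "smooth (\<lambda>p. \<Omega> p vs)" for vs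
      using smooth_scaleR[OF E smooth_const[of "basis_det vs"]] by (simp add: \<Omega>_def)
    moreover have "\<Omega> p basis_list \<noteq> 0" for p
      by (simp add: \<Omega>_def E_def basis_det_basis_list)
    ultimately show ?thesis
      using length_basis_list unfolding volume_form_on_def by blast
  qed
  have "nabla_form (projective_conn \<beta>) X \<Omega> Ys p = 0"
    if X: "smooth X" and len: "length Ys = ?m" and Ys: "\<forall>Y\<in>set Ys. smooth Y" for X Ys p
  proof -
    let ?vs = "map (\<lambda>Y. Y p) Ys"
    let ?Y' = "\<lambda>i. frechet_derivative (Ys ! i) (at p) (X p)"
    have vs: "length ?vs = ?m" by (simp add: len)
    have "((\<lambda>q. \<Omega> q (map (\<lambda>Y. Y q) Ys)) has_derivative (\<lambda>h.
        E p * (\<Sum>i<?m. basis_det (?vs[i := frechet_derivative (Ys ! i) (at p) h]))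
        + E p * ((real ?m + 1) * \<beta> p h) * basis_det ?vs)) (at p)"
      unfolding \<Omega>_def using Ys len
      by (intro has_derivative_mult dE has_derivative_basis_det smooth_has_derivative) auto
    then have d: "frechet_derivative (\<lambda>q. \<Omega> q (map (\<lambda>Y. Y q) Ys)) (at p) (X p) =
        E p * (\<Sum>i<?m. basis_det (?vs[i := ?Y' i]))
        + E p * ((real ?m + 1) * \<beta> p (X p)) * basis_det ?vs"
      by (simp add: frechet_derivative_eqI)
    \<comment> \<open>Linearity in slot \<open>i\<close> splits the connection into its three
      summands; the middle one is a multiple of the entry already there and returns the original
      determinant.\<close>
    have slot: "basis_det (?vs[i := projective_conn \<beta> X (Ys ! i) p]) =
        basis_det (?vs[i := ?Y' i]) + \<beta> p (X p) * basis_det ?vs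
        + \<beta> p (?vs ! i) * basis_det (?vs[i := X p])" if "i < ?m" for i
    proof -
      note l = alternating_form_linear[OF alternating_form_basis_det vs that]
      show ?thesis
        using list_update_id[of ?vs i] that len
        by (simp add: projective_conn_def linear_add[OF l] linear_cmul[OF l])
    qed
    have "(\<Sum>i<?m. \<Omega> p (map (\<lambda>Y. Y p) (Ys[i := projective_conn \<beta> X (Ys ! i)]))) =
        E p * ((\<Sum>i<?m. basis_det (?vs[i := ?Y' i])) + real ?m * (\<beta> p (X p) * basis_det ?vs)
          + (\<Sum>i<?m. \<beta> p (?vs ! i) * basis_det (?vs[i := X p])))"
      by (simp add: \<Omega>_def map_update slot sum.distrib flip: sum_distrib_left)
    \<comment> \<open>The trace identity turns the last sum into one more copy of
      \<open>\<beta> p (X p) * basis_det ?vs\<close>; with the \<open>m\<close> copies from the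
      slots it balances the derivative of \<open>E\<close>.\<close>
    then show ?thesis
      unfolding nabla_form_def len d
        alternating_form_rank_one_trace[OF alternating_form_basis_det vs lin(1)]
      by (simp add: algebra_simps)
  qed
  then have "parallel_on (projective_conn \<beta>) UNIV \<Omega>"
    by (simp add: parallel_on_def)
  with volume show ?thesis
    unfolding equiaffine_connection_def by blast
qed

lemma bilinear_ricci:
  assumes "algebraic_curvature_operator A"
  shows "bilinear (ricci A)"
proof -
  have "A b (x + y) z = A b x z + A b y z" "A b (c *\<^sub>R x) z = c *\<^sub>R A b x z"
    "A b z (x + y) = A b z x + A b z y" "A b z (c *\<^sub>R x) = c *\<^sub>R A b z x" for b x y z c
    using assms unfolding algebraic_curvature_operator_def linear_iff by blast+
  then show ?thesis
    unfolding bilinear_def ricci_def lin_trace_def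
    by (auto intro!: linearI simp: inner_add_left sum.distrib sum_distrib_left)
qed

theorem theorem4:
  fixes A :: "'a::euclidean_space \<Rightarrow> 'a \<Rightarrow> 'a \<Rightarrow> 'a"
  assumes "DIM('a) \<ge> 3"
    and "equiaffine_curvature_operator A"
    and "projectively_flat_operator A"
  shows "\<exists>D :: ('a \<Rightarrow> 'a) \<Rightarrow> ('a \<Rightarrow> 'a) \<Rightarrow> ('a \<Rightarrow> 'a).
           connection D \<and> torsion_free D \<and>
           equiaffine_connection D \<and> projectively_flat_connection D \<and>
           has_curvature_at D 0 A"
proof -
  define \<beta> where "\<beta> x y = - (1 / (real DIM('a) - 1)) * ricci A x y" for x y
  \<comment> \<open>Ricci symmetry enters here: symmetry of \<beta> is needed both for the curvature
    at the origin and for the parallel volume form.\<close>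
  have A: "algebraic_curvature_operator A" and sym: "\<beta> x y = \<beta> y x" for x y
    using assms(2) by (auto simp: equiaffine_curvature_operator_def \<beta>_def)
  have \<beta>: "bilinear \<beta>"
    using bilinear_ricci[OF A] unfolding bilinear_def \<beta>_def by (intro conjI allI linear_mult_right) auto
  have "A x y z = \<beta> x z *\<^sub>R y - \<beta> y z *\<^sub>R x" for x y z
    using assms(3) unfolding projectively_flat_operator_def weyl_projective_def \<beta>_def
    by (simp add: algebra_simps)
  then have "A = (\<lambda>x y z. \<beta> x z *\<^sub>R y - \<beta> y z *\<^sub>R x)"
    by (simp add: fun_eq_iff)
  then have "has_curvature_at (projective_conn \<beta>) 0 A"
    using has_curvature_at_zero_projective_conn[OF \<beta> sym] by simp
  then show ?thesis
    using bilinear_smooth_one_form[OF \<beta>] equiaffine_projective_conn[OF \<beta> sym]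
    by (intro exI[of _ "projective_conn \<beta>"] conjI connection_projective_conn
        torsion_free_projective_conn projectively_flat_projective_conn)
qed

end
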